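(* Let $p\in[1,+\infty]$, let $\mathcal{E}=\ell^p$ be the complex Banach space of $p$-summable (bounded if $p=\infty$) sequences $x=(x_n)_{n\in\mathbb{N}}$ (indexed from $0$), and let $\mathcal{F}=\{x\in \mathcal{E} : x_0=0\}$, which is a closed vector subspace of $\mathcal{E}$. Let $J:\mathcal{F}\to \mathcal{E}$ be the canonical injection, and let $T:\mathcal{F}\to \mathcal{E}$ be the restriction to $\mathcal{F}$ of the shift $S:\mathcal{E}\to \mathcal{E}$, $(Sx)_n=x_{n+1}$. Then: (i) $T$ is a linear isometry from $\mathcal{F}$ onto $\mathcal{E}$; (ii) $0\in\rho(T)$; (iii) if $\zeta\in\mathbb{C}$ and $|\zeta|>1$, then $\zeta\in\sigma(T)$.
   Context: $\mathcal{F}$ carries the norm induced from $\ell^p$. For the bounded operator $T:\mathcal{F}\to \mathcal{E}$, $\zeta\in\mathbb{C}$ is in the resolvent set $\rho(T)$ if $\zeta J-T:\mathcal{F}\to \mathcal{E}$ has an inverse that is a bounded linear map from $\mathcal{E}$ to $\mathcal{F}$; the spectrum is $\sigma(T)=\mathbb{C}\setminus\rho(T)$. *)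

theory Defs
  imports "HOL-Analysis.Analysis" "HOL-Library.Function_Algebras" "HOL-Library.FuncSet"
begin

type_synonym cseq = "nat \<Rightarrow> complex"

text \<open>Addition and subtraction of sequences are the pointwise operations of
  \<^theory>\<open>HOL-Library.Function_Algebras\<close>.\<close>

definition scale_seq :: "complex \<Rightarrow> cseq \<Rightarrow> cseq" where
  "scale_seq c x = (\<lambda>n. c * x n)"

interpretation seq: vector_space scale_seq
  by unfold_locales (auto simp: scale_seq_def fun_eq_iff algebra_simps)

definition lp :: "ennreal \<Rightarrow> cseq set" where
  "lp p = (if p = \<infinity> then {x. bounded (range x)}
           else {x. summable (\<lambda>n. norm (x n) powr enn2real p)})"

definition lp_norm :: "ennreal \<Rightarrow> cseq \<Rightarrow> real" where
  "lp_norm p x = (if p = \<infinity> then (SUP n. norm (x n))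
                  else (\<Sum>n. norm (x n) powr enn2real p) powr (1 / enn2real p))"

text \<open>The locale \<^locale>\<open>Metric_space\<close> asks for nonnegativity also off the carrier, where the
  supremum defining \<open>lp_norm \<infinity>\<close> is unspecified; hence the default value \<open>0\<close> there.\<close>

definition lp_dist :: "ennreal \<Rightarrow> cseq \<Rightarrow> cseq \<Rightarrow> real" where
  "lp_dist p x y = (if x \<in> lp p \<and> y \<in> lp p then lp_norm p (x - y) else 0)"

lemma powr_convex_nonneg:
  fixes q s u v :: real
  assumes q: "q \<ge> 1" and s: "0 \<le> s" "s \<le> 1" and u: "0 \<le> u" and v: "0 \<le> v"
  shows "(s * u + (1 - s) * v) powr q \<le> s * u powr q + (1 - s) * v powr q"
proof -
  have *: "(r * w) powr q \<le> r * w powr q" if "0 \<le> r" "r \<le> 1" "0 \<le> w" for r w :: real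
  proof -
    have "r powr q \<le> r"
    proof (cases "r = 0")
      case False
      then have "r powr q \<le> r powr 1"
        using that q by (intro powr_mono') auto
      then show ?thesis using that False by simp
    qed simp
    then show ?thesis using that by (simp add: powr_mult mult_right_mono)
  qed
  show ?thesis
  proof (cases "u = 0 \<or> v = 0")
    case True
    then show ?thesis using *[of s u] *[of "1 - s" v] s u v by auto
  next
    case False
    then show ?thesis
      using convex_onD[OF powr_convex[OF q], of "1 - s" u v] s u v by simp
  qed
qed

lemma lp_finite_exponent:
  assumes "1 \<le> p" "p \<noteq> \<infinity>"
  shows "1 \<le> enn2real p"
  using assms enn2real_mono[of 1 p] by (simp add: top.not_eq_extremum)

lemma lp_norm_nonneg:
  assumes "x \<in> lp p"
  shows "0 \<le> lp_norm p x"
proof (cases "p = \<infinity>")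
  case True
  then have "bdd_above (range (\<lambda>n. norm (x n)))"
    using assms by (auto simp: lp_def bounded_iff bdd_above_def)
  then have "norm (x 0) \<le> lp_norm p x"
    using True by (auto simp: lp_norm_def intro: cSUP_upper)
  then show ?thesis using norm_ge_zero[of "x 0"] by linarith
qed (simp add: lp_norm_def)

lemma lp_norm_eq_0:
  assumes p: "1 \<le> p" and x: "x \<in> lp p"
  shows "lp_norm p x = 0 \<longleftrightarrow> x = 0"
proof (cases "p = \<infinity>")
  case True
  then have "bdd_above (range (\<lambda>n. norm (x n)))"
    using x by (auto simp: lp_def bounded_iff bdd_above_def)
  then have "norm (x n) \<le> lp_norm p x" for n
    using True by (auto simp: lp_norm_def intro: cSUP_upper)
  then show ?thesis using True by (force simp: fun_eq_iff lp_norm_def)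
next
  case False
  then have "summable (\<lambda>n. norm (x n) powr enn2real p)" using x by (simp add: lp_def)
  then have "(\<Sum>n. norm (x n) powr enn2real p) = 0 \<longleftrightarrow> (\<forall>n. norm (x n) powr enn2real p = 0)"
    by (rule suminf_eq_zero_iff) simp
  then show ?thesis using False by (simp add: lp_norm_def fun_eq_iff)
qed

lemma lp_norm_powr:
  assumes "1 \<le> p" "p \<noteq> \<infinity>" "x \<in> lp p"
  shows "lp_norm p x powr enn2real p = (\<Sum>n. norm (x n) powr enn2real p)"
  using assms lp_finite_exponent[OF assms(1,2)]
  by (simp add: lp_norm_def lp_def powr_powr suminf_nonneg)

lemma Minkowski:
  assumes p: "1 \<le> p" and x: "x \<in> lp p" and y: "y \<in> lp p"
  shows "x + y \<in> lp p \<and> lp_norm p (x + y) \<le> lp_norm p x + lp_norm p y"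
proof (cases "p = \<infinity>")
  case True
  have bdd: "bdd_above (range (\<lambda>n. norm (z n)))" if "z \<in> lp p" for z
    using that True by (auto simp: lp_def bounded_iff bdd_above_def)
  have "norm (z n) \<le> lp_norm p z" if "z \<in> lp p" for z n
    using True bdd[OF that] by (auto simp: lp_norm_def intro: cSUP_upper)
  then have *: "norm ((x + y) n) \<le> lp_norm p x + lp_norm p y" for n
    using x y by (auto intro: norm_triangle_mono)
  then have "x + y \<in> lp p" using True by (auto simp: lp_def bounded_iff)
  moreover have "lp_norm p (x + y) \<le> lp_norm p x + lp_norm p y"
    using True * unfolding lp_norm_def[of p "x + y"] by (auto intro!: cSUP_least)
  ultimately show ?thesis by blast
next
  case False
  define q where "q = enn2real p"
  have q: "1 \<le> q" using lp_finite_exponent[OF p False] by (simp add: q_def)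
  define a where "a = lp_norm p x"
  define b where "b = lp_norm p y"
  have ab: "0 \<le> a" "0 \<le> b" using lp_norm_nonneg x y by (auto simp: a_def b_def)
  show ?thesis
  proof (cases "a = 0 \<or> b = 0")
    case True
    then have "x = 0 \<or> y = 0" using lp_norm_eq_0 p x y by (auto simp: a_def b_def)
    then show ?thesis using x y ab by (auto simp: a_def b_def)
  next
    case nz: False
    define s where "s = a / (a + b)"
    have pos: "0 < a" "0 < b" using ab nz by auto
    have s: "0 \<le> s" "s \<le> 1" "1 - s = b / (a + b)"
      using pos by (auto simp: s_def field_simps)
    have sx: "summable (\<lambda>n. norm (x n) powr q)" and sy: "summable (\<lambda>n. norm (y n) powr q)"
      using x y False by (auto simp: lp_def q_def)
    let ?g = "\<lambda>n. (a + b) powr q * (s * (norm (x n) powr q / a powr q)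
                 + (1 - s) * (norm (y n) powr q / b powr q))"
    have le: "norm ((x + y) n) powr q \<le> ?g n" for n
    proof -
      have "norm ((x + y) n) \<le> norm (x n) + norm (y n)"
        by (simp add: norm_triangle_ineq)
      also have "\<dots> = (a + b) * (s * (norm (x n) / a) + (1 - s) * (norm (y n) / b))"
      proof -
        have "(a + b) * s = a" "(a + b) * (1 - s) = b"
          using pos s(3) by (simp_all add: s_def)
        then have "(a + b) * (s * u + (1 - s) * v) = a * u + b * v" for u v
          by (metis distrib_left mult.assoc)
        from this[of "norm (x n) / a" "norm (y n) / b"] show ?thesis using pos by simp
      qed
      finally have "norm ((x + y) n) powr q
          \<le> ((a + b) * (s * (norm (x n) / a) + (1 - s) * (norm (y n) / b))) powr q"
        using q by (intro powr_mono2) auto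
      also have "\<dots> = (a + b) powr q * (s * (norm (x n) / a) + (1 - s) * (norm (y n) / b)) powr q"
        by (rule powr_mult)
      also have "\<dots> \<le> (a + b) powr q *
          (s * (norm (x n) / a) powr q + (1 - s) * (norm (y n) / b) powr q)"
        using pos s q by (intro mult_left_mono powr_convex_nonneg) auto
      also have "\<dots> = ?g n" using pos by (simp add: powr_divide)
      finally show ?thesis .
    qed
    have "(\<lambda>n. norm (x n) powr q) sums (a powr q)" "(\<lambda>n. norm (y n) powr q) sums (b powr q)"
      using sx sy lp_norm_powr[OF p False] x y
      by (auto simp: a_def b_def q_def summable_sums)
    then have "?g sums ((a + b) powr q * (s * (a powr q / a powr q)
                 + (1 - s) * (b powr q / b powr q)))"
      by (intro sums_mult sums_add sums_divide)
    then have g: "?g sums ((a + b) powr q)" using pos by simp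
    have sxy: "summable (\<lambda>n. norm ((x + y) n) powr q)"
      by (rule summable_comparison_test'[OF sums_summable[OF g], of 0]) (use le in auto)
    then have "(\<Sum>n. norm ((x + y) n) powr q) \<le> (a + b) powr q"
      using suminf_le[OF le sxy sums_summable[OF g]] sums_unique[OF g] by simp
    then have "(\<Sum>n. norm ((x + y) n) powr q) powr (1 / q) \<le> ((a + b) powr q) powr (1 / q)"
      using q sxy by (intro powr_mono2 suminf_nonneg) auto
    also have "\<dots> = a + b" using q pos by (simp add: powr_powr)
    finally show ?thesis using sxy False by (simp add: lp_def lp_norm_def a_def b_def q_def)
  qed
qed

lemma lp_scale:
  assumes "x \<in> lp p"
  shows "scale_seq c x \<in> lp p"
proof (cases "p = \<infinity>")
  case True
  then obtain B where "\<And>n. norm (x n) \<le> B" using assms by (auto simp: lp_def bounded_iff)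
  then have "norm (scale_seq c x n) \<le> norm c * B" for n
    by (simp add: scale_seq_def norm_mult mult_left_mono)
  then show ?thesis using True by (auto simp: lp_def bounded_iff)
next
  case False
  then show ?thesis using assms by (auto simp: lp_def scale_seq_def norm_mult powr_mult)
qed

lemma lp_diff:
  assumes "1 \<le> p" "x \<in> lp p" "y \<in> lp p"
  shows "x - y \<in> lp p"
proof -
  have "x - y = x + scale_seq (- 1) y" by (simp add: scale_seq_def fun_eq_iff)
  then show ?thesis using Minkowski[OF assms(1,2) lp_scale[OF assms(3)]] by metis
qed

lemma Metric_space_lp:
  assumes p: "1 \<le> p"
  shows "Metric_space (lp p) (lp_dist p)"
proof
  show "0 \<le> lp_dist p x y" for x y
    using lp_norm_nonneg lp_diff[OF p] by (simp add: lp_dist_def)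
  show "lp_dist p x y = lp_dist p y x" for x y
    by (simp add: lp_dist_def lp_norm_def norm_minus_commute)
  show "lp_dist p x y = 0 \<longleftrightarrow> x = y" if "x \<in> lp p" "y \<in> lp p" for x y
    using that lp_norm_eq_0[OF p lp_diff[OF p]] by (simp add: lp_dist_def)
  show "lp_dist p x z \<le> lp_dist p x y + lp_dist p y z"
    if "x \<in> lp p" "y \<in> lp p" "z \<in> lp p" for x y z
    using Minkowski[OF p lp_diff[OF p that(1,2)] lp_diff[OF p that(2,3)]] that
    by (simp add: lp_dist_def)
qed

definition lp0 :: "ennreal \<Rightarrow> cseq set" where
  "lp0 p = {x \<in> lp p. x 0 = 0}"

definition linear_map_on :: "cseq set \<Rightarrow> cseq set \<Rightarrow> (cseq \<Rightarrow> cseq) \<Rightarrow> bool" where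
  "linear_map_on U V A \<longleftrightarrow> A \<in> U \<rightarrow> V
     \<and> (\<forall>x\<in>U. \<forall>y\<in>U. A (x + y) = A x + A y)
     \<and> (\<forall>c. \<forall>x\<in>U. A (scale_seq c x) = scale_seq c (A x))"

definition bounded_linear_map_on ::
    "(cseq \<Rightarrow> real) \<Rightarrow> cseq set \<Rightarrow> cseq set \<Rightarrow> (cseq \<Rightarrow> cseq) \<Rightarrow> bool" where
  "bounded_linear_map_on N U V A \<longleftrightarrow>
     linear_map_on U V A \<and> (\<exists>K. \<forall>x\<in>U. N (A x) \<le> K * N x)"

definition inclusion :: "cseq set \<Rightarrow> cseq \<Rightarrow> cseq" where
  "inclusion F = (\<lambda>x\<in>F. x)"

definition shift :: "cseq \<Rightarrow> cseq" where
  "shift x = (\<lambda>n. x (Suc n))"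

definition shift0 :: "ennreal \<Rightarrow> cseq \<Rightarrow> cseq" where
  "shift0 p = restrict shift (lp0 p)"

text \<open>Resolvent set and spectrum of an operator \<open>A\<close> from a subspace \<open>F\<close> of the normed space
  \<open>(E, N)\<close> to \<open>E\<close>, where \<open>F\<close> carries the induced norm \<open>N\<close>.\<close>

definition resolvent_set ::
    "(cseq \<Rightarrow> real) \<Rightarrow> cseq set \<Rightarrow> cseq set \<Rightarrow> (cseq \<Rightarrow> cseq) \<Rightarrow> complex set" where
  "resolvent_set N F E A =
     {\<zeta>. \<exists>R. bounded_linear_map_on N E F R
        \<and> (\<forall>x\<in>F. R (scale_seq \<zeta> (inclusion F x) - A x) = x)
        \<and> (\<forall>y\<in>E. scale_seq \<zeta> (inclusion F (R y)) - A (R y) = y)}"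

definition op_spectrum ::
    "(cseq \<Rightarrow> real) \<Rightarrow> cseq set \<Rightarrow> cseq set \<Rightarrow> (cseq \<Rightarrow> cseq) \<Rightarrow> complex set" where
  "op_spectrum N F E A = UNIV - resolvent_set N F E A"

end

theory Submission
  imports Defs
begin

text \<open>Prepending a zero, \<open>case_nat 0\<close>, inverts the shift on \<open>lp0 p\<close>,
  and a vanishing zeroth term does not affect the norm (\<open>lp_norm_shift\<close>). Hence T is an
  isometric bijection, and its negative, the operator at \<zeta> = 0, has an isometric inverse. For
  \<zeta> of modulus above 1 surjectivity fails: the condition at index 0 turns the equation with
  right-hand side (1, 0, 0, ...) into a recursion whose only solution grows geometrically. This
  contradicts \<open>lp_norm_component_le\<close>, the continuity of coordinates, which also makes
  \<open>lp0 p\<close> closed.\<close>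

lemma lp_norm_component_le:
  assumes p: "1 \<le> p" and x: "x \<in> lp p"
  shows "norm (x n) \<le> lp_norm p x"
proof (cases "p = \<infinity>")
  case True
  then have "bdd_above (range (\<lambda>n. norm (x n)))"
    using x by (auto simp: lp_def bounded_iff bdd_above_def)
  then show ?thesis using True by (auto simp: lp_norm_def intro: cSUP_upper)
next
  case False
  define q where "q = enn2real p"
  have q: "1 \<le> q" using lp_finite_exponent[OF p False] by (simp add: q_def)
  have s: "summable (\<lambda>n. norm (x n) powr q)" using x False by (simp add: lp_def q_def)
  have "norm (x n) powr q \<le> (\<Sum>n. norm (x n) powr q)"
    using sum_le_suminf[OF s, of "{n}"] by simp
  then have "(norm (x n) powr q) powr (1 / q) \<le> (\<Sum>n. norm (x n) powr q) powr (1 / q)"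
    using q by (intro powr_mono2) auto
  then show ?thesis using q False by (simp add: powr_powr lp_norm_def q_def)
qed

lemma shift_case_nat [simp]: "shift (case_nat a y) = y"
  by (simp add: shift_def)

lemma case_nat_shift: "x 0 = a \<Longrightarrow> case_nat a (shift x) = x"
  by (auto simp: shift_def fun_eq_iff split: nat.split)

text \<open>A single term affects neither boundedness nor summability. Read from left to right, this
  puts sequences with a prepended term into \<open>lp p\<close>.\<close>

lemma shift_in_lp_iff: "shift x \<in> lp p \<longleftrightarrow> x \<in> lp p"
proof (cases "p = \<infinity>")
  case True
  have "range x = insert (x 0) (range (shift x))"
    unfolding shift_def by (subst UNIV_nat_eq) (simp add: image_image)
  then show ?thesis using True by (simp add: lp_def)
next
  case False
  then show ?thesis
    using summable_Suc_iff[of "\<lambda>n. norm (x n) powr enn2real p"] by (simp add: lp_def shift_def)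
qed

text \<open>The dropped term is 0: it adds nothing to the series, and it cannot raise a supremum of
  nonnegative numbers.\<close>

lemma lp_norm_shift:
  assumes x: "x \<in> lp0 p"
  shows "lp_norm p (shift x) = lp_norm p x"
proof (cases "p = \<infinity>")
  case True
  have bdd: "bdd_above (range (\<lambda>n. norm (z n)))" if "z \<in> lp p" for z
    using that True by (auto simp: lp_def bounded_iff bdd_above_def)
  have xs: "x \<in> lp p" "shift x \<in> lp p" "x 0 = 0"
    using x shift_in_lp_iff by (auto simp: lp0_def)
  have le: "norm (shift x n) \<le> (SUP n. norm (shift x n))" for n
    by (rule cSUP_upper[OF _ bdd[OF xs(2)]]) simp
  have "norm (x n) \<le> (SUP n. norm (shift x n))" for n
  proof (cases n)
    case 0
    show ?thesis using 0 xs(3) order_trans[OF norm_ge_zero le[of 0]] by simp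
  next
    case (Suc m)
    then show ?thesis using le[of m] by (simp add: shift_def)
  qed
  moreover have "norm (shift x n) \<le> (SUP n. norm (x n))" for n
    unfolding shift_def by (rule cSUP_upper[OF _ bdd[OF xs(1)]]) simp
  ultimately show ?thesis
    using True unfolding lp_norm_def by (auto intro!: antisym cSUP_least)
next
  case False
  have "summable (\<lambda>n. norm (x n) powr enn2real p)" "x 0 = 0"
    using x False by (auto simp: lp0_def lp_def)
  then have "(\<Sum>n. norm (x (Suc n)) powr enn2real p) = (\<Sum>n. norm (x n) powr enn2real p)"
    using suminf_split_head[of "\<lambda>n. norm (x n) powr enn2real p"] by simp
  then show ?thesis using False by (simp add: lp_norm_def shift_def)
qed

lemma subspace_lp0:
  assumes p: "1 \<le> p"
  shows "seq.subspace (lp0 p)"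
proof (rule seq.subspaceI)
  show "0 \<in> lp0 p" by (auto simp: lp0_def lp_def image_constant_conv zero_fun_def)
  show "x + y \<in> lp0 p" if "x \<in> lp0 p" "y \<in> lp0 p" for x y
    using that Minkowski[OF p] by (auto simp: lp0_def)
  show "scale_seq c x \<in> lp0 p" if "x \<in> lp0 p" for c x
    using that lp_scale by (auto simp: lp0_def scale_seq_def)
qed

lemma closedin_lp0:
  assumes p: "1 \<le> p"
  shows "closedin (Metric_space.mtopology (lp p) (lp_dist p)) (lp0 p)"
proof -
  interpret Metric_space "lp p" "lp_dist p" using p by (rule Metric_space_lp)
  have "\<exists>r>0. disjnt (lp0 p) (mball x r)" if x: "x \<in> lp p - lp0 p" for x
  proof (intro exI conjI)
    \<comment> \<open>This radius works because the zeroth coordinate of the difference between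
      \<open>x\<close> and a point of \<open>lp0 p\<close> is \<open>x 0\<close>, and it is bounded
      by the distance.\<close>
    show "0 < norm (x 0)" using x by (auto simp: lp0_def)
    have "norm (x 0) \<le> lp_dist p x y" if "y \<in> lp0 p" for y
      using that x lp_norm_component_le[OF p lp_diff[OF p, of x y], of 0]
      by (auto simp: lp0_def lp_dist_def)
    then show "disjnt (lp0 p) (mball x (norm (x 0)))"
      by (fastforce simp: disjnt_iff in_mball)
  qed
  then show ?thesis unfolding closedin_metric by (auto simp: lp0_def)
qed

lemma linear_map_on_shift0:
  assumes p: "1 \<le> p"
  shows "linear_map_on (lp0 p) (lp p) (shift0 p)"
  using seq.subspace_add[OF subspace_lp0[OF p]] seq.subspace_scale[OF subspace_lp0[OF p]]
  unfolding linear_map_on_def shift0_def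
  by (auto simp: shift_in_lp_iff lp0_def) (auto simp: shift_def scale_seq_def)

lemma case_nat_in_lp0:
  assumes "y \<in> lp p"
  shows "case_nat 0 y \<in> lp0 p"
  using assms shift_in_lp_iff[of "case_nat 0 y" p] by (simp add: lp0_def)

lemma shift0_image: "shift0 p ` lp0 p = lp p"
proof (intro equalityI subsetI)
  show "y \<in> lp p" if "y \<in> shift0 p ` lp0 p" for y
    using that shift_in_lp_iff by (auto simp: shift0_def lp0_def)
  show "y \<in> shift0 p ` lp0 p" if "y \<in> lp p" for y
    using case_nat_in_lp0[OF that] by (intro image_eqI[of _ _ "case_nat 0 y"]) (simp_all add: shift0_def)
qed

lemma zero_in_resolvent_set_shift0:
  assumes p: "1 \<le> p"
  shows "0 \<in> resolvent_set (lp_norm p) (lp0 p) (lp p) (shift0 p)"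
proof -
  \<comment> \<open>The sign comes from inverting 0 J - T = -T.\<close>
  define R :: "cseq \<Rightarrow> cseq" where "R y = case_nat 0 (- y)" for y
  have minus: "- y \<in> lp p" "lp_norm p (- y) = lp_norm p y" if "y \<in> lp p" for y
    using that by (auto simp: lp_def lp_norm_def bounded_iff)
  have R0: "R y \<in> lp0 p" if "y \<in> lp p" for y
    using case_nat_in_lp0[OF minus(1)[OF that]] by (simp add: R_def)
  have "lp_norm p (R y) = lp_norm p y" if "y \<in> lp p" for y
    using lp_norm_shift[OF R0[OF that]] minus(2)[OF that] by (simp add: R_def)
  then have bound: "\<exists>K. \<forall>y\<in>lp p. lp_norm p (R y) \<le> K * lp_norm p y"
    by (intro exI[of _ 1]) simp
  have "linear_map_on (lp p) (lp0 p) R"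
    using R0 unfolding linear_map_on_def
    by (auto simp: R_def scale_seq_def fun_eq_iff split: nat.split)
  with bound have "bounded_linear_map_on (lp_norm p) (lp p) (lp0 p) R"
    by (simp add: bounded_linear_map_on_def)
  moreover have "R (scale_seq 0 (inclusion (lp0 p) x) - shift0 p x) = x" if "x \<in> lp0 p" for x
    using that case_nat_shift[of x 0] by (simp add: R_def shift0_def lp0_def)
  moreover have "scale_seq 0 (inclusion (lp0 p) (R y)) - shift0 p (R y) = y" if "y \<in> lp p" for y
    using R0[OF that] by (simp add: shift0_def) (simp add: R_def)
  ultimately show ?thesis unfolding resolvent_set_def by blast
qed

text \<open>For \<open>\<bar>\<zeta>\<bar> > 1\<close> the operator \<open>\<zeta> J - T\<close> is not onto: since \<open>x\<^sub>0 = 0\<close>, the equation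
  \<open>\<zeta> x\<^sub>n - x\<^sub>n\<^sub>+\<^sub>1 = y\<^sub>n\<close> for \<open>y = (1, 0, 0, \<dots>)\<close> forces \<open>x\<^sub>n\<^sub>+\<^sub>1 = - \<zeta>\<^sup>n\<close>, which is unbounded.\<close>

lemma spectrum_shift0:
  assumes p: "1 \<le> p" and \<zeta>: "norm \<zeta> > 1"
  shows "\<zeta> \<in> op_spectrum (lp_norm p) (lp0 p) (lp p) (shift0 p)"
proof (rule ccontr)
  assume "\<not> ?thesis"
  then obtain R where R: "bounded_linear_map_on (lp_norm p) (lp p) (lp0 p) R"
    and eq: "\<And>y. y \<in> lp p \<Longrightarrow> scale_seq \<zeta> (inclusion (lp0 p) (R y)) - shift0 p (R y) = y"
    unfolding op_spectrum_def resolvent_set_def by blast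
  define y :: cseq where "y = case_nat 1 0"
  have "0 \<in> lp p" using seq.subspace_0[OF subspace_lp0[OF p]] by (simp add: lp0_def)
  \<comment> \<open>The shift of \<open>y\<close> is the zero sequence.\<close>
  then have y: "y \<in> lp p" using shift_in_lp_iff[of y p] by (simp add: y_def)
  define x where "x = R y"
  have x: "x \<in> lp0 p" "x \<in> lp p" "x 0 = 0"
    using R y by (auto simp: x_def bounded_linear_map_on_def linear_map_on_def lp0_def Pi_iff)
  \<comment> \<open>Membership of \<open>x\<close> in \<open>lp0 p\<close> matters here:
    \<open>inclusion\<close> and \<open>shift0\<close> are \<open>undefined\<close>
    elsewhere.\<close>
  have "scale_seq \<zeta> x - shift x = y"
    using eq[OF y] x(1) by (simp add: x_def inclusion_def shift0_def)
  then have rec: "\<zeta> * x n - x (Suc n) = y n" for n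
    by (auto simp: scale_seq_def shift_def fun_eq_iff)
  have xn: "x (Suc n) = - (\<zeta> ^ n)" for n
  proof (induction n)
    case 0
    show ?case using rec[of 0] x(3) by (simp add: y_def minus_equation_iff)
  next
    case (Suc n)
    then show ?case using rec[of "Suc n"] by (simp add: y_def)
  qed
  \<comment> \<open>Powers of a base above 1 exceed any bound, here the one that the norm puts on
    every coordinate of \<open>x\<close>.\<close>
  obtain n where "lp_norm p x < norm \<zeta> ^ n"
    using real_arch_pow[OF \<zeta>] by blast
  moreover have "norm (x (Suc n)) \<le> lp_norm p x"
    by (rule lp_norm_component_le[OF p x(2)])
  ultimately show False by (simp add: xn norm_power)
qed

theorem mainTheorem4:
  fixes p :: ennreal
  assumes "1 \<le> p"
  shows "seq.subspace (lp0 p)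
       \<and> closedin (Metric_space.mtopology (lp p) (lp_dist p)) (lp0 p)
       \<and> (linear_map_on (lp0 p) (lp p) (shift0 p)
          \<and> (\<forall>x\<in>lp0 p. lp_norm p (shift0 p x) = lp_norm p x)
          \<and> shift0 p ` lp0 p = lp p)
       \<and> 0 \<in> resolvent_set (lp_norm p) (lp0 p) (lp p) (shift0 p)
       \<and> (\<forall>\<zeta>::complex. norm \<zeta> > 1 \<longrightarrow>
             \<zeta> \<in> op_spectrum (lp_norm p) (lp0 p) (lp p) (shift0 p))"
  using subspace_lp0[OF assms] closedin_lp0[OF assms] linear_map_on_shift0[OF assms]
    shift0_image zero_in_resolvent_set_shift0[OF assms] spectrum_shift0[OF assms]
    lp_norm_shift[of _ p]
  by (simp add: shift0_def)

end
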